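(* Let $1<p\leq 3/2$ and let $u=u(x,t)$ be a smooth non-negative spatially fast decaying solution of the Cauchy problem $$\partial_t u = -\frac{1}{p-1}\left(u^p\left(u^{p-1}\right)_{xx}\right)_{xx},\qquad x\in\mathbb{R},\ t>0,$$ with initial data $u(\cdot,0)=u_0\ge 0$ satisfying $$\int_{\mathbb{R}} u_0\,\mathrm{d}x = 1,\qquad \int_{\mathbb{R}} x\,u_0\,\mathrm{d}x = 0,\qquad \int_{\mathbb{R}} x^2u_0\,\mathrm{d}x = \Theta_0,$$ and $\mathcal{R}_p(u_0)<+\infty$. Then there exists a constant $C>0$, independent of $u$, such that $$\|u(t)-U_p(t)\|_{L^1(\mathbb{R})}\leq C\left(\mathcal{R}_p(u(t)\,|\,U_p(t))\right)^{1/2}\qquad\text{for all } t>0,$$ where $U_p(t)$ is the Barenblatt profile of unit mass having the same second moment as $u(t)$, as defined in the context.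
   Context: For a probability density $f$ on $\mathbb{R}$ and $p\neq1$, the Rényi entropy of order $p$ is $\mathcal{R}_p(f)=\frac{1}{1-p}\ln\left(\int_{\mathbb{R}}f^p\,\mathrm{d}x\right)$. If $B$ is a Barenblatt profile of unit mass with the same (finite) second moment as $f$, the relative Rényi entropy is $\mathcal{R}_p(f|B)=\mathcal{R}_p(B)-\mathcal{R}_p(f)$, which is non-negative. The second moment is $\Theta(f)=\int_{\mathbb{R}}x^2f\,\mathrm{d}x$; write $\Theta_t=\Theta(u(t))$, so that $\Theta_0=\Theta(u_0)$, which is finite. "Smooth, spatially fast decaying" means that $u$ has enough regularity and decay at infinity for the standard integrations by parts to hold; in particular $u(t)$ has unit mass and finite second moment for all $t>0$. The profile $U_p$ is $$U_p(x,t)=\left(\frac{\Theta_t}{\Theta_0}\right)^{-1/2}\left(C_p-\frac{p-1}{p}\,\frac{\Theta_0}{\Theta_t}\,\frac{x^2}{2\sigma_t}\right)_+^{1/(p-1)},$$ where $(\cdot)_+=\max\{\cdot,0\}$ and the constants $C_p>0$, $\sigma_t>0$ are determined by requiring that $U_p(\cdot,t)$ has unit mass and second moment equal to $\Theta_t$. *)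

theory Defs
  imports "HOL-Analysis.Analysis"
begin

definition ext_ln :: "ennreal \<Rightarrow> ereal" where
  "ext_ln y = (if y = 0 then -\<infinity> else if y = top then \<infinity> else ereal (ln (enn2real y)))"

definition renyi_entropy :: "real \<Rightarrow> (real \<Rightarrow> real) \<Rightarrow> ereal" where
  "renyi_entropy p f = ereal (1 / (1 - p)) * ext_ln (\<integral>\<^sup>+x. ennreal (f x powr p) \<partial>lborel)"

definition relative_renyi_entropy :: "real \<Rightarrow> (real \<Rightarrow> real) \<Rightarrow> (real \<Rightarrow> real) \<Rightarrow> ereal" where
  "relative_renyi_entropy p f B = renyi_entropy p B - renyi_entropy p f"

definition second_moment :: "(real \<Rightarrow> real) \<Rightarrow> real" where
  "second_moment f = (LINT x|lborel. x\<^sup>2 * f x)"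

definition barenblatt :: "real \<Rightarrow> real \<Rightarrow> real \<Rightarrow> real \<Rightarrow> real \<Rightarrow> real \<Rightarrow> real" where
  "barenblatt p \<Theta>0 \<Theta>t c \<sigma> x =
     (\<Theta>t / \<Theta>0) powr (-1/2) *
     (max 0 (c - (p - 1) / p * (\<Theta>0 / \<Theta>t) * (x\<^sup>2 / (2 * \<sigma>)))) powr (1 / (p - 1))"

definition barenblatt_consts :: "real \<Rightarrow> real \<Rightarrow> real \<Rightarrow> real \<times> real" where
  "barenblatt_consts p \<Theta>0 \<Theta>t =
     (THE (c, \<sigma>). c > 0 \<and> \<sigma> > 0 \<and>
        has_bochner_integral lborel (barenblatt p \<Theta>0 \<Theta>t c \<sigma>) 1 \<and>
        has_bochner_integral lborel (\<lambda>x. x\<^sup>2 * barenblatt p \<Theta>0 \<Theta>t c \<sigma> x) \<Theta>t)"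

definition barenblatt_profile :: "real \<Rightarrow> real \<Rightarrow> real \<Rightarrow> real \<Rightarrow> real" where
  "barenblatt_profile p \<Theta>0 \<Theta>t =
     (case barenblatt_consts p \<Theta>0 \<Theta>t of (c, \<sigma>) \<Rightarrow> barenblatt p \<Theta>0 \<Theta>t c \<sigma>)"

text \<open>The expression \<open>w\<^sup>p (w\<^sup>p\<^sup>-\<^sup>1)\<^sub>x\<^sub>x\<close>. It is 0 wherever \<open>w = 0\<close>, whatever \<open>deriv\<close> returns
  there, so \<open>w\<^sup>p\<^sup>-\<^sup>1\<close> need only be twice differentiable on the set where \<open>w > 0\<close>.\<close>

definition flux :: "real \<Rightarrow> (real \<Rightarrow> real) \<Rightarrow> real \<Rightarrow> real" where
  "flux p w x = w x powr p * deriv (deriv (\<lambda>y. w y powr (p - 1))) x"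

text \<open>Smooth, spatially fast decaying non-negative solutions, with \<open>u t x\<close> for \<open>u(x,t)\<close>: every
  derivative in the equation exists in the classical sense, and the boundary terms at infinity
  vanish, locally uniformly in \<open>t > 0\<close>, when the equation is tested with
  \<open>1\<close>, \<open>x\<close>, \<open>x\<^sup>2\<close> (mass, mean, second moment) and \<open>u\<^sup>p\<^sup>-\<^sup>1\<close> (entropy).
  The initial datum, which may be rough, is attained in \<open>L\<^sup>1\<close>.\<close>

definition smooth_decaying_solution ::
    "real \<Rightarrow> (real \<Rightarrow> real) \<Rightarrow> (real \<Rightarrow> real \<Rightarrow> real) \<Rightarrow> bool" where
  "smooth_decaying_solution p u0 u \<longleftrightarrow>
     (\<forall>t>0. \<forall>x. 0 \<le> u t x) \<and>
     continuous_on ({0<..} \<times> UNIV) (\<lambda>(t, x). u t x) \<and>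
     (\<forall>t>0. \<forall>x. u t x > 0 \<longrightarrow>
        (\<lambda>y. u t y powr (p - 1)) differentiable (at x) \<and>
        deriv (\<lambda>y. u t y powr (p - 1)) differentiable (at x)) \<and>
     (\<forall>t>0. \<forall>x. flux p (u t) differentiable (at x) \<and>
        deriv (flux p (u t)) differentiable (at x)) \<and>
     continuous_on ({0<..} \<times> UNIV) (\<lambda>(t, x). deriv (deriv (flux p (u t))) x) \<and>
     (\<forall>t>0. \<forall>x. ((\<lambda>s. u s x) has_real_derivative
        - (1 / (p - 1)) * deriv (deriv (flux p (u t))) x) (at t)) \<and>
     (\<forall>t>0. (u t \<longlongrightarrow> 0) at_infinity) \<and>
     (\<forall>t>0. integrable lborel (\<lambda>x. x\<^sup>2 * u t x)) \<and>
     (\<forall>\<phi> \<in> {\<lambda>t x. 1, \<lambda>t x. x, \<lambda>t x. x\<^sup>2, \<lambda>t x. u t x powr (p - 1)}. \<forall>a>0. \<forall>b.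
        uniform_limit {a..b}
          (\<lambda>x t. \<phi> t x * deriv (flux p (u t)) x - deriv (\<phi> t) x * flux p (u t) x)
          (\<lambda>t. 0) at_infinity) \<and>
     u 0 = u0 \<and>
     ((\<lambda>t. \<integral>\<^sup>+x. ennreal \<bar>u t x - u0 x\<bar> \<partial>lborel) \<longlongrightarrow> 0) (at_right 0)"

end

theory Submission
  imports Defs
begin

text \<open>
  Testing the equation with \<open>1\<close> gives conservation of mass, so \<open>f = u(t)\<close> and the profile \<open>U\<close> have
  equal mass and second moment. On its support \<open>U\<^sup>p\<^sup>-\<^sup>1\<close> is the quadratic \<open>h(x) = a - bx\<^sup>2\<close>, and
  \<open>U\<^sup>p\<^sup>-\<^sup>1 = max 0 h\<close> everywhere, whence \<open>\<integral>f\<^sup>p - \<integral>U\<^sup>p\<close> equals \<open>\<integral>(f\<^sup>p - U\<^sup>p - p h (f - U))\<close>, whose integrand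
  is non-negative. For \<open>p \<le> 2\<close> it dominates a multiple of \<open>U\<^sup>p\<^sup>-\<^sup>2 (U - f)\<^sup>2\<close> where \<open>f < U\<close>. As
  \<open>\<parallel>f - U\<parallel>\<^sub>1 = 2\<integral>max 0 (U - f)\<close>, the Cauchy--Schwarz inequality bounds \<open>\<parallel>f - U\<parallel>\<^sub>1\<^sup>2\<close> by a multiple of
  \<open>\<integral>U\<^sup>2\<^sup>-\<^sup>p \<integral>U\<^sup>p\<close> times \<open>y = \<integral>f\<^sup>p / \<integral>U\<^sup>p - 1\<close>. The first product is scale invariant, and the relative
  entropy is \<open>ln (1 + y) / (p - 1)\<close>; for large \<open>y\<close> one uses that the distance is at most \<open>2\<close>.
\<close>

subsection \<open>Convexity of powers and the Csiszar--Kullback inequality\<close>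

text \<open>Young's inequality for the pair \<open>z\<close>, \<open>1\<close> with weights
  \<open>q\<close> and \<open>1 - q\<close>.\<close>

lemma powr_le_tangent_at_1:
  fixes q z :: real
  assumes "0 < q" "q \<le> 1" "0 \<le> z"
  shows "z powr q \<le> 1 + q * (z - 1)"
proof (cases "z = 0")
  case False
  then show ?thesis
    using Youngs_inequality_0[of q "1 - q" z 1] assms by (simp add: algebra_simps)
qed (use assms in simp)

text \<open>Reduction to the concave case: the previous bound with exponent \<open>1 / p\<close>,
  taken at the point \<open>z powr p\<close>.\<close>

lemma powr_ge_tangent_at_1:
  fixes p z :: real
  assumes "1 < p" "0 \<le> z"
  shows "1 + p * (z - 1) \<le> z powr p"
proof -
  have "(z powr p) powr (1 / p) \<le> 1 + 1 / p * (z powr p - 1)"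
    using assms by (intro powr_le_tangent_at_1) auto
  also have "(z powr p) powr (1 / p) = z"
    using assms by (simp add: powr_powr)
  finally show ?thesis
    using assms by (simp add: field_simps)
qed

text \<open>Below 1 the second derivative \<open>p * (p - 1) * x powr (p - 2)\<close> is at least
  \<open>p * (p - 1)\<close> because \<open>p \<le> 2\<close>, which gives the quadratic gain. Above
  1 the left side vanishes and the tangent bound suffices.\<close>

lemma powr_bregman_unit:
  fixes p z :: real
  assumes "1 < p" "p \<le> 2" "0 \<le> z"
  shows "p * (p - 1) / 2 * (max 0 (1 - z))\<^sup>2 \<le> z powr p - 1 - p * (z - 1)"
proof (cases "z \<le> 1")
  case True
  \<comment> \<open>\<open>?g 1 = 0\<close>, and \<open>?g\<close> decreases on the interval: its
    derivative is non-positive by the tangent bound for the exponent \<open>p - 1\<close>, which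
    lies in (0, 1].\<close>
  let ?g = "\<lambda>z. z powr p - 1 - p * (z - 1) - p * (p - 1) / 2 * (1 - z)\<^sup>2"
  have "?g 1 \<le> ?g z"
  proof (rule DERIV_nonpos_imp_decreasing_open[OF True])
    fix x :: real
    assume x: "z < x" "x < 1"
    then have "0 < x" using assms by simp
    then have "(?g has_real_derivative p * x powr (p - 1) - p + p * (p - 1) * (1 - x)) (at x)"
      by (auto intro!: derivative_eq_intros simp: field_simps)
    moreover have "x powr (p - 1) \<le> 1 + (p - 1) * (x - 1)"
      using assms \<open>0 < x\<close> by (intro powr_le_tangent_at_1) auto
    then have "p * x powr (p - 1) \<le> p * (1 + (p - 1) * (x - 1))"
      using assms by (intro mult_left_mono) auto
    then have "p * x powr (p - 1) - p + p * (p - 1) * (1 - x) \<le> 0"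
      by (simp add: algebra_simps)
    ultimately show "\<exists>y. (?g has_real_derivative y) (at x) \<and> y \<le> 0" by blast
  next
    show "continuous_on {z..1} ?g"
      using assms by (intro continuous_intros continuous_on_powr') auto
  qed
  with True show ?thesis by (simp add: max_def)
next
  case False
  then show ?thesis using powr_ge_tangent_at_1[of p z] assms by simp
qed

text \<open>Homogeneity: the unit case at \<open>z = s / v\<close>, multiplied by
  \<open>v powr p\<close>.\<close>

lemma powr_bregman:
  fixes p s v :: real
  assumes p: "1 < p" "p \<le> 2" and s: "0 \<le> s" and v: "0 < v"
  shows "p * (p - 1) / 2 * (v powr (p - 2) * (max 0 (v - s))\<^sup>2)
           \<le> s powr p - v powr p - p * v powr (p - 1) * (s - v)"
proof -
  have 1: "max 0 (v - s) = v * max 0 (1 - s / v)"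
    using v by (simp add: max_mult_distrib_left right_diff_distrib)
  have 2: "v powr (p - 2) * v\<^sup>2 = v powr p"
    using v by (simp add: powr_diff)
  have 3: "s powr p = v powr p * (s / v) powr p"
    using v s by (simp add: powr_divide)
  have 4: "v powr (p - 1) * (s - v) = v powr p * (s / v - 1)"
    using v by (simp add: powr_diff field_simps)
  have "p * (p - 1) / 2 * (v powr (p - 2) * (max 0 (v - s))\<^sup>2)
          = v powr (p - 2) * v\<^sup>2 * (p * (p - 1) / 2 * (max 0 (1 - s / v))\<^sup>2)"
    unfolding 1 by (simp add: power_mult_distrib)
  also have "\<dots> \<le> v powr p * ((s / v) powr p - 1 - p * (s / v - 1))"
    unfolding 2 using p s v by (intro mult_left_mono powr_bregman_unit) auto
  also have "\<dots> = s powr p - v powr p - p * (v powr (p - 1) * (s - v))"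
    unfolding 3 4 by (simp add: algebra_simps)
  finally show ?thesis by (simp add: mult.assoc)
qed

section \<open>Cauchy--Schwarz and the Csiszar--Kullback inequality\<close>

lemma integral_mult_squared_le:
  fixes f g :: "'a \<Rightarrow> real"
  assumes [measurable]: "f \<in> borel_measurable M" "g \<in> borel_measurable M"
    and "\<And>x. 0 \<le> f x" "\<And>x. 0 \<le> g x"
    and "integrable M (\<lambda>x. f x * g x)" "integrable M (\<lambda>x. (f x)\<^sup>2)" "integrable M (\<lambda>x. (g x)\<^sup>2)"
  shows "(LINT x|M. f x * g x)\<^sup>2 \<le> (LINT x|M. (f x)\<^sup>2) * (LINT x|M. (g x)\<^sup>2)"
proof -
  have "(\<integral>\<^sup>+x. ennreal (f x) * ennreal (g x) \<partial>M)\<^sup>2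
          \<le> (\<integral>\<^sup>+x. (ennreal (f x))\<^sup>2 \<partial>M) * (\<integral>\<^sup>+x. (ennreal (g x))\<^sup>2 \<partial>M)"
    by (intro Cauchy_Schwarz_nn_integral) auto
  then have "ennreal ((LINT x|M. f x * g x)\<^sup>2)
               \<le> ennreal ((LINT x|M. (f x)\<^sup>2) * (LINT x|M. (g x)\<^sup>2))"
    using assms
    by (simp add: ennreal_mult[symmetric] ennreal_power nn_integral_eq_integral)
  then show ?thesis
    by (simp add: ennreal_le_iff)
qed

text \<open>\<open>h\<close> continues \<open>U powr (p - 1)\<close> by non-positive values where
  \<open>U\<close> vanishes. Because \<open>f\<close> and \<open>U\<close> have the same integral
  against \<open>h\<close>, the linear term of the Bregman remainder integrates to zero.\<close>

lemma csiszar_kullback_powr: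
  fixes f U h :: "'a \<Rightarrow> real"
  assumes p: "1 < p" "p \<le> 2"
    and f: "\<And>x. 0 \<le> f x" and U: "\<And>x. 0 \<le> U x"
    and int: "integrable M f" "integrable M U"
      "integrable M (\<lambda>x. f x powr p)" "integrable M (\<lambda>x. U x powr p)"
      "integrable M (\<lambda>x. U x powr (2 - p))"
      "integrable M (\<lambda>x. h x * f x)" "integrable M (\<lambda>x. h x * U x)"
    and mass: "(LINT x|M. f x) = (LINT x|M. U x)"
    and moment: "(LINT x|M. h x * f x) = (LINT x|M. h x * U x)"
    and h: "\<And>x. U x powr (p - 1) = max 0 (h x)"
  shows "(LINT x|M. \<bar>f x - U x\<bar>)\<^sup>2 \<le> 8 / (p * (p - 1)) *
    ((LINT x|M. U x powr (2 - p)) * ((LINT x|M. f x powr p) - (LINT x|M. U x powr p)))"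
proof -
  define d where "d x = max 0 (U x - f x)" for x
  \<comment> \<open>As \<open>0 powr q = 0\<close> even for \<open>q < 0\<close>, \<open>w\<close> vanishes where \<open>U\<close> does.\<close>
  define w where "w x = U x powr (p - 2) * (d x)\<^sup>2" for x
  define D where "D x = f x powr p - U x powr p - p * (h x * f x - h x * U x)" for x
  have [measurable]: "f \<in> borel_measurable M" "U \<in> borel_measurable M"
    using int by auto
  have [measurable]: "d \<in> borel_measurable M" "w \<in> borel_measurable M"
    unfolding d_def w_def by measurable
  have d0: "0 \<le> d x" and w0: "0 \<le> w x" for x
    by (auto simp: d_def w_def)
  \<comment> \<open>Where \<open>U\<close> vanishes, \<open>h\<close> is non-positive, so the term
    with \<open>h * f\<close> can only increase \<open>D\<close>. Where \<open>U\<close> is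
    positive, \<open>h\<close> equals \<open>U powr (p - 1)\<close> and the pointwise Bregman bound
    applies.\<close>
  have wD: "p * (p - 1) / 2 * w x \<le> D x" for x
  proof (cases "U x = 0")
    case True
    then have "h x \<le> 0" using h[of x] p by (simp add: max_def split: if_splits)
    then have "p * (h x * f x) \<le> 0"
      using p f[of x] by (simp add: mult_le_0_iff)
    then have "p * (h x * f x) \<le> f x powr p"
      by (rule order_trans) simp
    then show ?thesis using True p by (simp add: D_def w_def)
  next
    case False
    then have "0 < U x" using U[of x] by simp
    moreover from this have "h x = U x powr (p - 1)"
      using h[of x] powr_gt_zero[of "U x" "p - 1"] by (auto simp: max_def split: if_splits)
    ultimately show ?thesis
      using powr_bregman[OF p f[of x], of "U x"]
      by (simp add: D_def w_def d_def algebra_simps)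
  qed
  have intD: "integrable M D"
    unfolding D_def using int by auto
  have intw: "integrable M w"
  proof (rule Bochner_Integration.integrable_bound)
    show "integrable M (\<lambda>x. 2 / (p * (p - 1)) * D x)" using intD by auto
    have "w x \<le> 2 / (p * (p - 1)) * D x" for x
      using wD[of x] p by (simp add: field_simps)
    then show "AE x in M. norm (w x) \<le> norm (2 / (p * (p - 1)) * D x)"
      using w0 by (simp add: order_trans[OF _ abs_ge_self] del: abs_mult abs_divide)
  qed auto
  have "p * (p - 1) / 2 * (LINT x|M. w x) \<le> (LINT x|M. D x)"
    unfolding integral_mult_right_zero[symmetric]
    using intw intD wD by (intro integral_mono) auto
  also have "(LINT x|M. D x) = (LINT x|M. f x powr p) - (LINT x|M. U x powr p)"
    unfolding D_def using int moment by simp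
  finally have W: "(LINT x|M. w x)
      \<le> 2 / (p * (p - 1)) * ((LINT x|M. f x powr p) - (LINT x|M. U x powr p))"
    using p by (simp add: field_simps)
  have intd: "integrable M d"
    unfolding d_def using int by auto
  \<comment> \<open>The factorization for Cauchy--Schwarz; the second factor squares to
    \<open>w\<close>. Where \<open>U x = 0\<close>, also \<open>d x = 0\<close> since
    \<open>f\<close> is non-negative.\<close>
  have eqd: "U x powr ((2 - p) / 2) * (U x powr ((p - 2) / 2) * d x) = d x" for x
  proof (cases "U x = 0")
    case True
    then show ?thesis using f[of x] by (simp add: d_def)
  next
    case False
    then have "U x powr ((2 - p) / 2) * U x powr ((p - 2) / 2) = 1"
      using U[of x] by (simp add: powr_add[symmetric] add_divide_distrib[symmetric])
    then show ?thesis by (simp add: mult.assoc[symmetric])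
  qed
  have sq1: "(U x powr ((2 - p) / 2))\<^sup>2 = U x powr (2 - p)" for x
    by (simp add: power2_eq_square powr_add[symmetric])
  have sq2: "(U x powr ((p - 2) / 2) * d x)\<^sup>2 = w x" for x
    by (simp add: power2_eq_square powr_add[symmetric] w_def ac_simps)
  have "(LINT x|M. U x powr ((2 - p) / 2) * (U x powr ((p - 2) / 2) * d x))\<^sup>2
      \<le> (LINT x|M. (U x powr ((2 - p) / 2))\<^sup>2) * (LINT x|M. (U x powr ((p - 2) / 2) * d x)\<^sup>2)"
    using int intd intw d0 by (intro integral_mult_squared_le) (auto simp: eqd sq1 sq2)
  then have "(LINT x|M. d x)\<^sup>2 \<le> (LINT x|M. U x powr (2 - p)) * (LINT x|M. w x)"
    unfolding eqd sq1 sq2 .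
  also have "\<dots> \<le> (LINT x|M. U x powr (2 - p)) *
      (2 / (p * (p - 1)) * ((LINT x|M. f x powr p) - (LINT x|M. U x powr p)))"
    by (intro mult_left_mono W) auto
  also have "\<dots> = 8 / (p * (p - 1)) * ((LINT x|M. U x powr (2 - p)) *
      ((LINT x|M. f x powr p) - (LINT x|M. U x powr p))) / 4"
    by simp
  finally have d2: "4 * (LINT x|M. d x)\<^sup>2 \<le> 8 / (p * (p - 1)) * ((LINT x|M. U x powr (2 - p)) *
      ((LINT x|M. f x powr p) - (LINT x|M. U x powr p)))"
    unfolding le_divide_eq_numeral1 by (simp only: mult.commute)
  \<comment> \<open>Equal masses give the positive and negative parts of \<open>f - U\<close> the
    same integral. Squaring this factor 2 turns the constant \<open>2 / (p * (p - 1))\<close> into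
    \<open>8 / (p * (p - 1))\<close>.\<close>
  have "(LINT x|M. \<bar>f x - U x\<bar>) = 2 * (LINT x|M. d x)"
  proof -
    have "(LINT x|M. \<bar>f x - U x\<bar>) = (LINT x|M. 2 * d x + (f x - U x))"
      by (intro Bochner_Integration.integral_cong) (auto simp: d_def max_def)
    also have "\<dots> = 2 * (LINT x|M. d x)"
      using int intd mass by simp
    finally show ?thesis .
  qed
  then have "(LINT x|M. \<bar>f x - U x\<bar>)\<^sup>2 = 4 * (LINT x|M. d x)\<^sup>2"
    by (simp add: power_mult_distrib)
  then show ?thesis using d2 by simp
qed

subsection \<open>Barenblatt profiles\<close>

text \<open>Normal form of a profile, with support [-1, 1]: every profile is
  \<open>a * barenblatt_shape m (x / r)\<close> with \<open>m = 1 / (p - 1)\<close>, amplitude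
  \<open>a\<close> and support radius \<open>r\<close>.\<close>

definition barenblatt_shape :: "real \<Rightarrow> real \<Rightarrow> real" where
  "barenblatt_shape m x = max 0 (1 - x\<^sup>2) powr m"

lemma barenblatt_shape_nonneg: "0 \<le> barenblatt_shape m x"
  by (simp add: barenblatt_shape_def)

lemma barenblatt_shape_le_1: "0 < m \<Longrightarrow> barenblatt_shape m x \<le> 1"
  by (auto simp: barenblatt_shape_def intro!: powr_le1)

lemma barenblatt_shape_eq_0: "1 \<le> \<bar>x\<bar> \<Longrightarrow> barenblatt_shape m x = 0"
  by (simp add: barenblatt_shape_def max_def abs_square_le_1 antisym abs_le_square_iff[of 1, simplified])

lemma continuous_on_barenblatt_shape: "0 < m \<Longrightarrow> continuous_on A (barenblatt_shape m)"
  unfolding barenblatt_shape_def[abs_def]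
  by (rule continuous_on_powr') (auto intro!: continuous_intros)

lemma barenblatt_shape_ge: 
  assumes "0 < m" "\<bar>x\<bar> \<le> 1 / 2"
  shows "(3 / 4) powr m \<le> barenblatt_shape m x"
proof -
  have "x\<^sup>2 \<le> (1 / 2)\<^sup>2" using assms abs_le_square_iff[of x "1/2"] by simp
  then show ?thesis unfolding barenblatt_shape_def
    using assms by (intro powr_mono2) (auto simp: power2_eq_square)
qed

lemma integrable_barenblatt_shape_moment:
  assumes "0 < m"
  shows "integrable lborel (\<lambda>x. x ^ k * barenblatt_shape m x)"
proof -
  have "integrable lborel (\<lambda>x. indicator {-1..1} x *\<^sub>R (x ^ k * barenblatt_shape m x))"
    using assms by (intro borel_integrable_compact continuous_intros continuous_on_barenblatt_shape) auto
  also have "(\<lambda>x. indicator {-1..1} x *\<^sub>R (x ^ k * barenblatt_shape m x)) = (\<lambda>x. x ^ k * barenblatt_shape m x)"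
    by (auto simp: indicator_def fun_eq_iff intro: barenblatt_shape_eq_0)
  finally show ?thesis .
qed

text \<open>For \<open>m > 0\<close> the mass and the second moment of the shape are the Beta values
  B(1/2, m+1) and B(3/2, m+1).\<close>

definition barenblatt_mass :: "real \<Rightarrow> real" where
  "barenblatt_mass m = (LINT x|lborel. barenblatt_shape m x)"

definition barenblatt_moment :: "real \<Rightarrow> real" where
  "barenblatt_moment m = (LINT x|lborel. x\<^sup>2 * barenblatt_shape m x)"

text \<open>The shape is at least \<open>(3 / 4) powr m\<close> on [-1/2, 1/2], an interval of
  length 1. This makes the final constant explicit.\<close>

lemma barenblatt_mass_ge:
  assumes "0 < m"
  shows "(3 / 4) powr m \<le> barenblatt_mass m"
proof -
  have "(LINT x|lborel. indicator {-1/2..1/2::real} x * (3 / 4 :: real) powr m) \<le> barenblatt_mass m"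
    unfolding barenblatt_mass_def
    using integrable_barenblatt_shape_moment[OF assms, of 0] assms
    by (intro integral_mono) (auto split: split_indicator intro!: barenblatt_shape_ge barenblatt_shape_nonneg)
  then show ?thesis by simp
qed

lemma barenblatt_moment_pos:
  assumes "0 < m"
  shows "0 < barenblatt_moment m"
proof -
  have "1 / 16 * (3 / 4) powr m \<le> x\<^sup>2 * barenblatt_shape m x" if "1 / 4 \<le> x" "x \<le> 1 / 2" for x :: real
    using that assms power_mono[of "1/4" x 2]
    by (intro mult_mono barenblatt_shape_ge) (auto simp: power2_eq_square)
  then have "(LINT x|lborel. indicator {1/4..1/2::real} x * (1 / 16 * (3 / 4 :: real) powr m)) \<le> barenblatt_moment m"
    unfolding barenblatt_moment_def
    using integrable_barenblatt_shape_moment[OF assms, of 2] assms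
    by (intro integral_mono) (auto split: split_indicator intro!: barenblatt_shape_nonneg mult_nonneg_nonneg)
  \<comment> \<open>64 is 16 from \<open>x\<^sup>2 \<ge> 1 / 16\<close> times 4 from the interval
    length 1/4.\<close>
  then have "(3 / 4) powr m \<le> 64 * barenblatt_moment m" by simp
  moreover have "0 < (3 / 4 :: real) powr m" by simp
  ultimately show ?thesis by linarith
qed

lemma barenblatt_mass_pos: "0 < m \<Longrightarrow> 0 < barenblatt_mass m"
  using barenblatt_mass_ge[of m] less_le_trans[of 0 "(3 / 4) powr m"] by simp

section \<open>Rescaled shapes and the constants of the profile\<close>

lemma has_bochner_integral_scaled_barenblatt_shape:
  assumes "0 < m" "0 < r"
  shows "has_bochner_integral lborel (\<lambda>x. a * barenblatt_shape m (x / r)) (a * r * barenblatt_mass m)"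
    and "has_bochner_integral lborel (\<lambda>x. x\<^sup>2 * (a * barenblatt_shape m (x / r))) (a * r ^ 3 * barenblatt_moment m)"
proof -
  have "has_bochner_integral lborel (\<lambda>x. a * barenblatt_shape m x) (a * barenblatt_mass m)"
    using integrable_barenblatt_shape_moment[OF assms(1), of 0]
    by (auto simp: has_bochner_integral_iff barenblatt_mass_def)
  then show "has_bochner_integral lborel (\<lambda>x. a * barenblatt_shape m (x / r)) (a * r * barenblatt_mass m)"
    using assms by (subst lborel_has_bochner_integral_real_affine_iff[of r _ _ 0]) (auto simp: field_simps)
  have "has_bochner_integral lborel (\<lambda>x. (a * r\<^sup>2) * (x\<^sup>2 * barenblatt_shape m x)) ((a * r\<^sup>2) * barenblatt_moment m)"
    using integrable_barenblatt_shape_moment[OF assms(1), of 2]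
    by (auto simp: has_bochner_integral_iff barenblatt_moment_def)
  then show "has_bochner_integral lborel (\<lambda>x. x\<^sup>2 * (a * barenblatt_shape m (x / r))) (a * r ^ 3 * barenblatt_moment m)"
    using assms by (subst lborel_has_bochner_integral_real_affine_iff[of r _ _ 0])
      (auto simp: field_simps power2_eq_square power3_eq_cube)
qed

text \<open>Factoring \<open>c\<close> out of the bracket leaves \<open>1 - (x / s)\<^sup>2\<close>
  with \<open>s\<^sup>2 = c * \<sigma> / \<delta>\<close>, so the support radius is that square
  root.\<close>

lemma barenblatt_eq_shape:
  assumes "1 < p" "0 < \<Theta>0" "0 < \<Theta>t" "0 < c" "0 < \<sigma>"
  defines "\<delta> \<equiv> (p - 1) / p * (\<Theta>0 / \<Theta>t) / 2"
  shows "barenblatt p \<Theta>0 \<Theta>t c \<sigma> x = (\<Theta>t / \<Theta>0) powr (-1/2) * c powr (1 / (p - 1)) *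
           barenblatt_shape (1 / (p - 1)) (x / sqrt (c * \<sigma> / \<delta>))"
proof -
  have \<delta>: "0 < \<delta>" using assms by simp
  have "(x / sqrt (c * \<sigma> / \<delta>))\<^sup>2 = \<delta> * x\<^sup>2 / (c * \<sigma>)"
    using assms(4,5) \<delta> by (simp add: power_divide)
  then have "c * (1 - (x / sqrt (c * \<sigma> / \<delta>))\<^sup>2) = c - \<delta> * x\<^sup>2 / \<sigma>"
    using assms(4,5) by (simp add: field_simps)
  then have "max 0 (c - (p - 1) / p * (\<Theta>0 / \<Theta>t) * (x\<^sup>2 / (2 * \<sigma>)))
      = c * max 0 (1 - (x / sqrt (c * \<sigma> / \<delta>))\<^sup>2)"
    using assms(4) by (simp add: max_mult_distrib_left \<delta>_def)
  then show ?thesis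
    using assms(4) by (simp add: barenblatt_def barenblatt_shape_def powr_mult)
qed

text \<open>The definite description is meaningful because exactly one pair qualifies: in terms of
  amplitude and radius, the ratio of the two moment conditions fixes the radius, then the mass fixes
  the amplitude.\<close>

lemma barenblatt_consts_moments:
  assumes p: "1 < p" and \<Theta>: "0 < \<Theta>0" "0 < \<Theta>t"
  obtains c \<sigma> where "barenblatt_consts p \<Theta>0 \<Theta>t = (c, \<sigma>)" "0 < c" "0 < \<sigma>"
    "has_bochner_integral lborel (barenblatt p \<Theta>0 \<Theta>t c \<sigma>) 1"
    "has_bochner_integral lborel (\<lambda>x. x\<^sup>2 * barenblatt p \<Theta>0 \<Theta>t c \<sigma> x) \<Theta>t"
proof -
  define m where "m = 1 / (p - 1)"
  define \<delta> where "\<delta> = (p - 1) / p * (\<Theta>0 / \<Theta>t) / 2"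
  define \<kappa> where "\<kappa> = (\<Theta>t / \<Theta>0) powr (-1/2)"
  \<comment> \<open>\<open>r\<close> solves the ratio of the two conditions; \<open>c\<close> then
    solves the mass condition, the power \<open>p - 1\<close> inverting the power
    \<open>m\<close>.\<close>
  define r where "r = sqrt (\<Theta>t * barenblatt_mass m / barenblatt_moment m)"
  define c where "c = (1 / (\<kappa> * r * barenblatt_mass m)) powr (p - 1)"
  have m: "0 < m" using p by (simp add: m_def)
  note pos = barenblatt_mass_pos[OF m] barenblatt_moment_pos[OF m]
  have \<delta>: "0 < \<delta>" and \<kappa>: "0 < \<kappa>" using p \<Theta> by (auto simp: \<delta>_def \<kappa>_def)
  have r: "0 < r" using pos \<Theta> by (simp add: r_def)
  have r2: "r\<^sup>2 = \<Theta>t * barenblatt_mass m / barenblatt_moment m"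
    using pos \<Theta> by (simp add: r_def)
  have c: "0 < c" using \<kappa> r pos by (simp add: c_def)
  have cm: "c powr m = 1 / (\<kappa> * r * barenblatt_mass m)"
    using \<kappa> r pos p by (simp add: c_def powr_powr m_def)
  \<comment> \<open>Non-positive pairs are included, both sides being false there, so the
    equivalence rewrites the whole description.\<close>
  have *: "b > 0 \<and> \<sigma> > 0 \<and>
        has_bochner_integral lborel (barenblatt p \<Theta>0 \<Theta>t b \<sigma>) 1 \<and>
        has_bochner_integral lborel (\<lambda>x. x\<^sup>2 * barenblatt p \<Theta>0 \<Theta>t b \<sigma> x) \<Theta>t
      \<longleftrightarrow> b = c \<and> \<sigma> = \<delta> * r\<^sup>2 / c" (is "?L b \<sigma> \<longleftrightarrow> ?R b \<sigma>") for b \<sigma>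
  proof (cases "0 < b \<and> 0 < \<sigma>")
    case False
    then show ?thesis using c \<delta> r by auto
  next
    case True
    define s where "s = sqrt (b * \<sigma> / \<delta>)"
    define a where "a = \<kappa> * b powr m"
    have s: "0 < s" and s2: "s\<^sup>2 = b * \<sigma> / \<delta>" using True \<delta> by (auto simp: s_def)
    have a: "0 < a" using True \<kappa> by (simp add: a_def)
    have eq: "barenblatt p \<Theta>0 \<Theta>t b \<sigma> = (\<lambda>x. a * barenblatt_shape m (x / s))"
      unfolding m_def a_def s_def \<kappa>_def \<delta>_def
      using True by (intro ext barenblatt_eq_shape[OF p \<Theta>]) auto
    note moments = has_bochner_integral_scaled_barenblatt_shape[OF m s, of a]
    \<comment> \<open>Values of integrals are unique, so the two integral conditions become
      algebraic equations in \<open>a\<close> and \<open>s\<close>.\<close>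
    have "?L b \<sigma> \<longleftrightarrow> a * s * barenblatt_mass m = 1 \<and> a * s ^ 3 * barenblatt_moment m = \<Theta>t"
      unfolding eq using True moments has_bochner_integral_eq[OF moments(1), of 1]
        has_bochner_integral_eq[OF moments(2), of \<Theta>t] by auto
    also have "\<dots> \<longleftrightarrow> s = r \<and> a = \<kappa> * c powr m"
    proof (rule iffI)
      assume "a * s * barenblatt_mass m = 1 \<and> a * s ^ 3 * barenblatt_moment m = \<Theta>t"
      then have 1: "a * s * barenblatt_mass m = 1"
        and 2: "a * s ^ 3 * barenblatt_moment m = \<Theta>t"
        by auto
      \<comment> \<open>The quotient of the two equations in product form: cancelling
        \<open>a * s\<close> eliminates the amplitude.\<close>
      have "a * s ^ 3 * barenblatt_moment m * (a * s * barenblatt_mass m)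
          = s\<^sup>2 * barenblatt_moment m * (a * s) * (a * s * barenblatt_mass m)"
        by (simp add: power2_eq_square power3_eq_cube)
      then have "s\<^sup>2 * barenblatt_moment m * (a * s) = a * s * barenblatt_mass m * \<Theta>t"
        unfolding 1 2 by simp
      then have "s\<^sup>2 * barenblatt_moment m = barenblatt_mass m * \<Theta>t"
        using a s by simp
      then have "s\<^sup>2 = r\<^sup>2"
        unfolding r2 using pos by (simp add: field_simps)
      then have "s = r" using s r by (simp add: power2_eq_iff_nonneg)
      moreover from this have "a = \<kappa> * c powr m"
        unfolding cm using 1 \<kappa> r pos by (simp add: field_simps)
      ultimately show "s = r \<and> a = \<kappa> * c powr m" ..
    next
      assume 3: "s = r \<and> a = \<kappa> * c powr m"
      have 1: "\<kappa> * c powr m * r * barenblatt_mass m = 1"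
        unfolding cm using \<kappa> r pos by simp
      have "\<kappa> * c powr m * r ^ 3 * barenblatt_moment m
          = (\<kappa> * c powr m * r * barenblatt_mass m) * (r\<^sup>2 * barenblatt_moment m / barenblatt_mass m)"
        using pos by (simp add: power2_eq_square power3_eq_cube)
      then have "\<kappa> * c powr m * r ^ 3 * barenblatt_moment m = \<Theta>t"
        unfolding 1 r2 using pos by simp
      with 1 3 show "a * s * barenblatt_mass m = 1 \<and> a * s ^ 3 * barenblatt_moment m = \<Theta>t"
        by simp
    qed
    also have "a = \<kappa> * c powr m \<longleftrightarrow> b = c"
    proof
      assume "a = \<kappa> * c powr m"
      then have "(b powr m) powr (p - 1) = (c powr m) powr (p - 1)"
        using \<kappa> by (simp add: a_def)
      then show "b = c"
        using True c p by (simp add: powr_powr m_def)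
    qed (simp add: a_def)
    also have "s = r \<and> b = c \<longleftrightarrow> ?R b \<sigma>"
    proof -
      have "s = r \<longleftrightarrow> s\<^sup>2 = r\<^sup>2" using s r by (simp add: power2_eq_iff_nonneg)
      also have "\<dots> \<longleftrightarrow> \<sigma> = \<delta> * r\<^sup>2 / b"
        unfolding s2 using True \<delta> by (auto simp: field_simps)
      finally show ?thesis by auto
    qed
    finally show ?thesis .
  qed
  have "barenblatt_consts p \<Theta>0 \<Theta>t = (c, \<delta> * r\<^sup>2 / c)"
    unfolding barenblatt_consts_def
    by (rule the_equality) (simp_all only: * split_paired_all prod.case prod.inject simp_thms)
  with that show thesis using *[of c "\<delta> * r\<^sup>2 / c"] by blast
qed

lemma barenblatt_profile_eq_shape:
  assumes p: "1 < p" and \<Theta>: "0 < \<Theta>0" "0 < \<Theta>t"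
  obtains a r where "0 < a" "0 < r"
    "barenblatt_profile p \<Theta>0 \<Theta>t = (\<lambda>x. a * barenblatt_shape (1 / (p - 1)) (x / r))"
    "has_bochner_integral lborel (barenblatt_profile p \<Theta>0 \<Theta>t) 1"
    "has_bochner_integral lborel (\<lambda>x. x\<^sup>2 * barenblatt_profile p \<Theta>0 \<Theta>t x) \<Theta>t"
proof -
  obtain c \<sigma> where c: "barenblatt_consts p \<Theta>0 \<Theta>t = (c, \<sigma>)" "0 < c" "0 < \<sigma>"
    and "has_bochner_integral lborel (barenblatt p \<Theta>0 \<Theta>t c \<sigma>) 1"
    and "has_bochner_integral lborel (\<lambda>x. x\<^sup>2 * barenblatt p \<Theta>0 \<Theta>t c \<sigma> x) \<Theta>t"
    using barenblatt_consts_moments[OF assms] by blast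
  moreover have "barenblatt_profile p \<Theta>0 \<Theta>t = barenblatt p \<Theta>0 \<Theta>t c \<sigma>"
    by (simp add: barenblatt_profile_def c)
  ultimately show thesis
    using barenblatt_eq_shape[OF assms c(2,3)] assms
    by (intro that[of "(\<Theta>t / \<Theta>0) powr (-1/2) * c powr (1 / (p - 1))"
          "sqrt (c * \<sigma> / ((p - 1) / p * (\<Theta>0 / \<Theta>t) / 2))"]) auto
qed

subsection \<open>Conservation of mass\<close>

lemma continuous_on_slice:
  assumes "continuous_on (A \<times> UNIV) (\<lambda>(t, x). f t x)" "t \<in> A"
  shows "continuous_on UNIV (f t)"
proof -
  have "continuous_on UNIV ((\<lambda>(t, x). f t x) \<circ> Pair t)"
    using assms(2) by (intro continuous_on_compose continuous_intros continuous_on_subset[OF assms(1)]) auto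
  then show ?thesis by (simp add: o_def)
qed

text \<open>Links the integrals over bounded intervals, where the Leibniz rule and the fundamental
  theorem apply, to the Lebesgue integral over the line, by dominated convergence.\<close>

lemma integral_symmetric_interval_tendsto_lborel:
  fixes f :: "real \<Rightarrow> real"
  assumes cont: "continuous_on UNIV f" and int: "integrable lborel f"
  shows "((\<lambda>R. integral {-R..R} f) \<longlongrightarrow> (LINT x|lborel. f x)) at_top"
proof -
  have "((\<lambda>R. LINT x|lborel. indicator {-R..R} x * f x) \<longlongrightarrow> (LINT x|lborel. f x)) at_top"
  proof (rule integral_dominated_convergence_at_top)
    show "integrable lborel (\<lambda>x. \<bar>f x\<bar>)" using int by simp
    show "AE x in lborel. ((\<lambda>R. indicator {-R..R} x * f x) \<longlongrightarrow> f x) at_top"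
    proof (rule AE_I2)
      fix x :: real
      have "eventually (\<lambda>R. indicator {-R..R} x * f x = f x) at_top"
        using eventually_ge_at_top[of "\<bar>x\<bar>"] by eventually_elim (auto simp: indicator_def abs_le_iff)
      then show "((\<lambda>R. indicator {-R..R} x * f x) \<longlongrightarrow> f x) at_top"
        by (rule tendsto_eventually)
    qed
  qed (use int in \<open>auto split: split_indicator\<close>)
  moreover have "(LINT x|lborel. indicator {-R..R} x * f x) = integral {-R..R} f" for R
    using set_borel_integral_eq_integral(2)[of "{-R..R}" f]
      borel_integrable_atLeastAtMost'[of "-R" R f] continuous_on_subset[OF cont]
    by (simp add: set_lebesgue_integral_def)
  ultimately show ?thesis by simp
qed

text \<open>Continuity handles [-1, 1]; outside it \<open>x\<^sup>2 \<ge> 1\<close>, so the second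
  moment dominates.\<close>

lemma smooth_decaying_solution_integrable:
  assumes sol: "smooth_decaying_solution p u0 u" and t: "0 < t"
  shows "integrable lborel (u t)"
proof (rule Bochner_Integration.integrable_bound)
  have cont: "continuous_on UNIV (u t)"
    using sol t unfolding smooth_decaying_solution_def by (intro continuous_on_slice[of "{0<..}"]) auto
  then show "u t \<in> borel_measurable lborel"
    by (simp add: borel_measurable_continuous_onI)
  show "integrable lborel (\<lambda>x. indicator {-1..1} x *\<^sub>R u t x + x\<^sup>2 * u t x)"
    using sol t unfolding smooth_decaying_solution_def
    by (intro Bochner_Integration.integrable_add borel_integrable_compact continuous_on_subset[OF cont]) auto
  have "u t x \<le> indicator {-1..1} x *\<^sub>R u t x + x\<^sup>2 * u t x" "0 \<le> u t x" for x
  proof -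
    show u: "0 \<le> u t x" using sol t unfolding smooth_decaying_solution_def by auto
    show "u t x \<le> indicator {-1..1} x *\<^sub>R u t x + x\<^sup>2 * u t x"
    proof (cases "\<bar>x\<bar> \<le> 1")
      case False
      then have "1 \<le> x\<^sup>2" using abs_le_square_iff[of 1 x] by simp
      then have "u t x \<le> x\<^sup>2 * u t x" using u mult_right_mono[of 1 "x\<^sup>2" "u t x"] by simp
      then show ?thesis using False by (auto simp: indicator_def)
    qed (use u in \<open>auto simp: indicator_def abs_le_iff\<close>)
  qed
  then show "AE x in lborel. norm (u t x) \<le> norm (indicator {-1..1} x *\<^sub>R u t x + x\<^sup>2 * u t x)"
    by (simp add: order_trans[OF _ abs_ge_self])
qed

text \<open>The mass in \<open>{-R..R}\<close> changes only through the boundary values of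
  \<open>F\<close>, which vanish uniformly in time as \<open>R\<close> grows.\<close>

lemma smooth_decaying_solution_mass_eq:
  assumes p: "1 < p" and sol: "smooth_decaying_solution p u0 u" and ab: "0 < a" "a < b"
  shows "(LINT x|lborel. u a x) = (LINT x|lborel. u b x)"
proof -
  define F where "F t x = deriv (flux p (u t)) x" for t x
  have cont_u: "continuous_on UNIV (u t)" if "0 < t" for t
    using sol that unfolding smooth_decaying_solution_def by (intro continuous_on_slice[of "{0<..}"]) auto
  have cont_F': "continuous_on ({0<..} \<times> UNIV) (\<lambda>(t, x). deriv (F t) x)"
    using sol unfolding smooth_decaying_solution_def F_def[abs_def] by auto
  have DF: "(F t has_real_derivative deriv (F t) x) (at x)" if "0 < t" for t x
    using sol that unfolding smooth_decaying_solution_def F_def[abs_def]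
    by (auto simp: DERIV_deriv_iff_real_differentiable)
  have Du: "((\<lambda>s. u s x) has_real_derivative - (1 / (p - 1)) * deriv (F t) x) (at t)" if "0 < t" for t x
    using sol that unfolding smooth_decaying_solution_def F_def[abs_def] by auto
  \<comment> \<open>The test function 1: its derivative is zero, so only the term with
    \<open>F\<close> remains.\<close>
  have lim_F: "uniform_limit {a..b} (\<lambda>x t. F t x) (\<lambda>t. 0) at_infinity"
    using sol ab unfolding smooth_decaying_solution_def F_def[abs_def] by auto
  define m where "m R t = integral {-R..R} (u t)" for R t
  have Dm: "(m R has_real_derivative - (1 / (p - 1)) * (F t R - F t (-R))) (at t)"
    if t: "0 < t" and R: "0 < R" for t R
  proof -
    have "((\<lambda>t. integral (cbox (-R) R) (u t)) has_field_derivative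
        integral (cbox (-R) R) (\<lambda>x. - (1 / (p - 1)) * deriv (F t) x)) (at t within {0<..})"
    proof (rule leibniz_rule_field_derivative)
      show "((\<lambda>s. u s x) has_field_derivative - (1 / (p - 1)) * deriv (F s) x) (at s within {0<..})"
        if "s \<in> {0<..}" for s x
        using Du that by (auto intro: DERIV_subset)
      show "u s integrable_on cbox (-R) R" if "s \<in> {0<..}" for s
        using that by (intro integrable_continuous continuous_on_subset[OF cont_u]) auto
      show "continuous_on ({0<..} \<times> cbox (-R) R) (\<lambda>(t, x). - (1 / (p - 1)) * deriv (F t) x)"
        unfolding case_prod_unfold
        by (intro continuous_intros continuous_on_subset[OF cont_F'[unfolded case_prod_unfold]]) auto
    qed (use t in auto)
    moreover have "integral (cbox (-R) R) (\<lambda>x. - (1 / (p - 1)) * deriv (F t) x) = - (1 / (p - 1)) * (F t R - F t (-R))"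
      using R DF[OF t] unfolding cbox_interval
      by (intro integral_unique has_integral_mult_right fundamental_theorem_of_calculus)
        (auto simp: has_real_derivative_iff_has_vector_derivative[symmetric] intro: DERIV_subset)
    moreover have "at t within {0<..} = at t"
      using t by (intro at_within_open) auto
    ultimately show ?thesis
      using p by (simp add: m_def[abs_def])
  qed
  have "((\<lambda>R. m R b - m R a) \<longlongrightarrow> 0) at_top"
  proof (rule tendstoI)
    fix e :: real
    assume e: "0 < e"
    \<comment> \<open>Chosen so that boundary values below \<open>d\<close> change the mass by less
      than \<open>2 * k * d = e\<close>.\<close>
    define k where "k = (b - a) / (p - 1)"
    have k: "0 < k" using p ab by (simp add: k_def)
    define d where "d = e / (2 * k)"
    have d: "0 < d" using e k by (simp add: d_def)
    obtain B where "\<forall>x. B \<le> \<bar>x\<bar> \<longrightarrow> (\<forall>t\<in>{a..b}. \<bar>F t x\<bar> < d)"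
      using lim_F[unfolded uniform_limit_iff, rule_format, OF d]
      unfolding eventually_at_infinity by auto
    then have B: "\<bar>F t x\<bar> < d" if "B \<le> \<bar>x\<bar>" "t \<in> {a..b}" for t x
      using that by blast
    have "\<bar>m R b - m R a\<bar> < e" if R: "0 < R" "B \<le> R" for R
    proof -
      \<comment> \<open>The intermediate time \<open>z\<close> depends on \<open>R\<close>;
        uniformity of the boundary limit on \<open>{a..b}\<close> covers this.\<close>
      obtain z where z: "a < z" "z < b"
        "m R b - m R a = (b - a) * (- (1 / (p - 1)) * (F z R - F z (-R)))"
        using MVT2[of a b "m R" "\<lambda>t. - (1 / (p - 1)) * (F t R - F t (-R))"] Dm[OF _ R(1)] ab by auto
      have "\<bar>F z R\<bar> < d" "\<bar>F z (-R)\<bar> < d" using z R by (auto intro!: B)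
      then have "\<bar>F z R - F z (-R)\<bar> < 2 * d" by linarith
      then have "k * \<bar>F z R - F z (-R)\<bar> < k * (2 * d)"
        using k by (intro mult_strict_left_mono) auto
      also have "\<dots> = e" using k by (simp add: d_def)
      also have "k * \<bar>F z R - F z (-R)\<bar> = \<bar>m R b - m R a\<bar>"
        unfolding z(3) using p ab by (simp add: abs_mult k_def)
      finally show ?thesis .
    qed
    then show "\<forall>\<^sub>F R in at_top. dist (m R b - m R a) 0 < e"
      unfolding eventually_at_top_linorder by (intro exI[of _ "max 1 B"]) auto
  qed
  moreover have "((\<lambda>R. m R b - m R a) \<longlongrightarrow> (LINT x|lborel. u b x) - (LINT x|lborel. u a x)) at_top"
    unfolding m_def using ab sol
    by (intro tendsto_diff integral_symmetric_interval_tendsto_lborel cont_u smooth_decaying_solution_integrable) auto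
  ultimately have "(LINT x|lborel. u b x) - (LINT x|lborel. u a x) = 0"
    using tendsto_unique[OF trivial_limit_at_top_linorder] by blast
  then show ?thesis by simp
qed

text \<open>The mass at time \<open>t\<close> equals that at every \<open>s\<close> in (0, t), so
  its distance to the initial mass is at most the distance in L1 of \<open>u s\<close> to
  \<open>u0\<close>, which tends to 0.\<close>

lemma smooth_decaying_solution_mass:
  assumes p: "1 < p" and sol: "smooth_decaying_solution p u0 u"
    and u0: "integrable lborel u0" and t: "0 < t"
  shows "(LINT x|lborel. u t x) = (LINT x|lborel. u0 x)"
proof -
  have "((\<lambda>s. \<integral>\<^sup>+x. ennreal \<bar>u s x - u0 x\<bar> \<partial>lborel) \<longlongrightarrow> 0) (at_right 0)"
    using sol unfolding smooth_decaying_solution_def by auto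
  moreover have "\<forall>\<^sub>F s in at_right 0. ennreal \<bar>(LINT x|lborel. u t x) - (LINT x|lborel. u0 x)\<bar>
      \<le> (\<integral>\<^sup>+x. ennreal \<bar>u s x - u0 x\<bar> \<partial>lborel)"
    using eventually_at_right_real[OF t]
  proof eventually_elim
    fix s assume s: "s \<in> {0<..<t}"
    have int: "integrable lborel (u s)"
      using s by (intro smooth_decaying_solution_integrable[OF sol]) auto
    have "\<bar>(LINT x|lborel. u t x) - (LINT x|lborel. u0 x)\<bar> = \<bar>LINT x|lborel. u s x - u0 x\<bar>"
      using s smooth_decaying_solution_mass_eq[OF p sol, of s t] int u0 by simp
    also have "\<dots> \<le> (LINT x|lborel. \<bar>u s x - u0 x\<bar>)"
      by (rule integral_abs_bound)
    finally show "ennreal \<bar>(LINT x|lborel. u t x) - (LINT x|lborel. u0 x)\<bar>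
      \<le> (\<integral>\<^sup>+x. ennreal \<bar>u s x - u0 x\<bar> \<partial>lborel)"
      using int u0 by (subst nn_integral_eq_integral) auto
  qed
  ultimately have "ennreal \<bar>(LINT x|lborel. u t x) - (LINT x|lborel. u0 x)\<bar> \<le> 0"
    using tendsto_lowerbound trivial_limit_at_right_real by blast
  then show ?thesis by simp
qed

subsection \<open>Relative entropy controls the distance to the profile\<close>

lemma integral_powr_pos:
  fixes f :: "'a \<Rightarrow> real"
  assumes "\<And>x. 0 \<le> f x" "integrable M (\<lambda>x. f x powr q)" "0 < (LINT x|M. f x)"
  shows "0 < (LINT x|M. f x powr q)"
proof (rule ccontr)
  assume "\<not> 0 < (LINT x|M. f x powr q)"
  moreover have "0 \<le> (LINT x|M. f x powr q)" by simp
  ultimately have "(LINT x|M. f x powr q) = 0" by linarith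
  then have "AE x in M. f x = 0"
    using assms(2) by (subst (asm) integral_nonneg_eq_0_iff_AE) auto
  then have "(LINT x|M. f x) = 0"
    using integral_eq_zero_AE by blast
  with assms(3) show False by simp
qed

lemma renyi_entropy_eq_ln:
  assumes "integrable lborel (\<lambda>x. f x powr p)" "0 < (LINT x|lborel. f x powr p)"
  shows "renyi_entropy p f = ereal (1 / (1 - p) * ln (LINT x|lborel. f x powr p))"
proof -
  have "(\<integral>\<^sup>+x. ennreal (f x powr p) \<partial>lborel) = ennreal (LINT x|lborel. f x powr p)"
    using assms(1) by (intro nn_integral_eq_integral) auto
  moreover have "ext_ln (ennreal y) = ereal (ln y)" if "0 < y" for y
    using that by (auto simp: ext_ln_def)
  ultimately show ?thesis
    using assms(2) by (simp add: renyi_entropy_def)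
qed

text \<open>Both entropies are finite, so \<open>real_of_ereal\<close> loses nothing; the factor
  \<open>p - 1\<close> cancels \<open>1 / (1 - p)\<close> up to the sign that puts \<open>f\<close>
  in the numerator.\<close>

lemma relative_renyi_entropy_eq_ln:
  assumes "1 < p"
    and "integrable lborel (\<lambda>x. f x powr p)" "0 < (LINT x|lborel. f x powr p)"
    and "integrable lborel (\<lambda>x. g x powr p)" "0 < (LINT x|lborel. g x powr p)"
  shows "(p - 1) * real_of_ereal (relative_renyi_entropy p f g)
      = ln ((LINT x|lborel. f x powr p) / (LINT x|lborel. g x powr p))"
proof -
  have "(p - 1) * (1 / (1 - p)) = -1" using assms(1) by (simp add: divide_simps)
  then have "(p - 1) * (1 / (1 - p) * z) = - z" for z
    by (simp only: mult.assoc[symmetric] mult_minus1)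
  then show ?thesis
    using assms by (simp add: relative_renyi_entropy_def renyi_entropy_eq_ln ln_div right_diff_distrib)
qed

text \<open>With \<open>U \<le> a\<close> on a support of length \<open>2 * r\<close>, the powers of
  \<open>a\<close> combine to \<open>2 * (a * r)\<close>, and unit mass bounds \<open>a * r\<close>.
  Thus the bound depends on \<open>p\<close> alone.\<close>

lemma barenblatt_shape_powr_bounds:
  fixes a r p :: real
  assumes p: "1 < p" "p \<le> 2" and ar: "0 < a" "0 < r"
  defines "U \<equiv> \<lambda>x. a * barenblatt_shape (1 / (p - 1)) (x / r)"
  assumes mass: "has_bochner_integral lborel U 1"
  shows "integrable lborel (\<lambda>x. U x powr (2 - p))" "integrable lborel (\<lambda>x. U x powr p)"
    and "(LINT x|lborel. U x powr (2 - p)) * (LINT x|lborel. U x powr p) \<le> 2 * (4 / 3) powr (1 / (p - 1))"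
proof -
  define m where "m = 1 / (p - 1)"
  have m: "0 < m" using p by (simp add: m_def)
  have U0: "0 \<le> U x" and Ua: "U x \<le> a" for x
    using barenblatt_shape_nonneg[of m "x / r"] barenblatt_shape_le_1[OF m, of "x / r"] ar
    by (auto simp: U_def m_def mult_left_le)
  have int: "integrable lborel U" and int1: "(LINT x|lborel. U x) = 1"
    using mass by (auto simp: has_bochner_integral_iff)
  then have [measurable]: "U \<in> borel_measurable borel" by auto
  have le1: "U x powr (2 - p) \<le> indicator {-r..r} x * a powr (2 - p)" for x
  proof (cases "\<bar>x\<bar> \<le> r")
    case True
    then show ?thesis using U0[of x] Ua[of x] p by (auto simp: abs_le_iff intro!: powr_mono2)
  next
    case False
    \<comment> \<open>Since \<open>0 powr 0 = 0\<close>, the case \<open>p = 2\<close> also vanishes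
      off the support.\<close>
    then have "U x = 0" using ar by (simp add: U_def barenblatt_shape_eq_0 field_simps)
    then show ?thesis by simp
  qed
  have le2: "U x powr p \<le> a powr (p - 1) * U x" for x
  proof (cases "U x = 0")
    case False
    then have "U x powr p = U x powr (p - 1) * U x"
      using U0[of x] by (simp add: powr_diff)
    then show ?thesis using U0[of x] Ua[of x] p by (auto intro!: mult_right_mono powr_mono2)
  qed simp
  have i1: "integrable lborel (\<lambda>x. indicator {-r..r} x * a powr (2 - p))"
    by (intro integrable_mult_left integrable_real_indicator) (simp_all add: emeasure_lborel_Icc_eq)
  have i2: "integrable lborel (\<lambda>x. a powr (p - 1) * U x)" using int by simp
  show I1: "integrable lborel (\<lambda>x. U x powr (2 - p))"
    by (rule Bochner_Integration.integrable_bound[OF i1]) (use le1 in auto)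
  show I2: "integrable lborel (\<lambda>x. U x powr p)"
    by (rule Bochner_Integration.integrable_bound[OF i2]) (use le2 U0 in auto)
  have "(LINT x|lborel. U x powr (2 - p)) \<le> (LINT x|lborel. indicator {-r..r} x * a powr (2 - p))"
    using I1 i1 le1 by (intro integral_mono) auto
  also have "\<dots> = 2 * r * a powr (2 - p)" using ar by simp
  finally have b1: "(LINT x|lborel. U x powr (2 - p)) \<le> 2 * r * a powr (2 - p)" .
  have "(LINT x|lborel. U x powr p) \<le> (LINT x|lborel. a powr (p - 1) * U x)"
    using I2 i2 le2 by (intro integral_mono) auto
  also have "\<dots> = a powr (p - 1)" using int1 by simp
  finally have b2: "(LINT x|lborel. U x powr p) \<le> a powr (p - 1)" .
  have "(LINT x|lborel. U x powr (2 - p)) * (LINT x|lborel. U x powr p)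
      \<le> 2 * r * a powr (2 - p) * a powr (p - 1)"
    using b1 b2 ar by (intro mult_mono) auto
  also have "\<dots> = 2 * (a * r)"
    using ar by (simp add: mult.assoc powr_add[symmetric])
  \<comment> \<open>Unit mass makes \<open>a * r\<close> the reciprocal of
    \<open>barenblatt_mass m\<close>.\<close>
  also have "a * r \<le> (4 / 3) powr m"
  proof -
    have "a * r * barenblatt_mass m = 1"
      using has_bochner_integral_eq[OF mass] has_bochner_integral_scaled_barenblatt_shape(1)[OF m ar(2), of a]
      unfolding U_def m_def by simp
    then have "a * r * (3 / 4) powr m \<le> 1"
      using barenblatt_mass_ge[OF m] ar by (metis mult_left_mono mult_nonneg_nonneg less_imp_le)
    moreover have "(3 / 4 :: real) powr m * (4 / 3) powr m = 1"
      by (simp add: powr_mult[symmetric])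
    ultimately show ?thesis
      using mult_right_mono[of "a * r * (3 / 4) powr m" 1 "(4 / 3) powr m"] by (simp add: mult.assoc)
  qed
  finally show "(LINT x|lborel. U x powr (2 - p)) * (LINT x|lborel. U x powr p)
      \<le> 2 * (4 / 3) powr (1 / (p - 1))"
    by (simp add: m_def)
qed

text \<open>Merges the bounds for small and large \<open>y\<close>: adding
  \<open>n \<le> K * y\<close> and \<open>n * y \<le> c * y\<close> gives a multiple of
  \<open>y / (1 + y)\<close>, which is at most \<open>ln (1 + y)\<close>.\<close>

lemma le_ln_one_plus:
  fixes n K y :: real
  assumes "n \<le> K * y" "n \<le> c" "0 \<le> K" "0 \<le> c" "0 \<le> y"
  shows "n \<le> (K + c) * ln (1 + y)"
proof -
  have "n * (1 + y) \<le> (K + c) * y"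
    using assms mult_right_mono[OF assms(2,5)] by (simp add: algebra_simps)
  then have "n \<le> (K + c) * (y / (1 + y))"
    using assms(5) by (simp add: field_simps)
  also have "y / (1 + y) \<le> ln (1 + y)"
    using ln_le_minus_one[of "1 / (1 + y)"] assms(5) by (simp add: ln_div field_simps)
  finally show ?thesis using assms(3,4) by (simp add: mult_left_mono)
qed

text \<open>The factor \<open>8 / (p (p - 1))\<close> comes from the Csiszar--Kullback inequality, \<open>2 (4/3)\<^sup>m\<close> bounds
  \<open>\<integral>U\<^sup>2\<^sup>-\<^sup>p \<integral>U\<^sup>p\<close>, and \<open>4\<close> bounds the squared distance of two probability densities.\<close>

definition renyi_csiszar_kullback_const :: "real \<Rightarrow> real" where
  "renyi_csiszar_kullback_const p = sqrt ((16 / (p * (p - 1)) * (4 / 3) powr (1 / (p - 1)) + 4) * (p - 1))"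

lemma l1_dist_barenblatt_le_relative_renyi_entropy:
  fixes f :: "real \<Rightarrow> real" and a r p :: real
  assumes p: "1 < p" "p \<le> 2" and ar: "0 < a" "0 < r"
    and f: "\<And>x. 0 \<le> f x" "has_bochner_integral lborel f 1"
      "has_bochner_integral lborel (\<lambda>x. x\<^sup>2 * f x) \<Theta>" "integrable lborel (\<lambda>x. f x powr p)"
  defines "U \<equiv> \<lambda>x. a * barenblatt_shape (1 / (p - 1)) (x / r)"
  assumes U: "has_bochner_integral lborel U 1" "has_bochner_integral lborel (\<lambda>x. x\<^sup>2 * U x) \<Theta>"
  shows "(LINT x|lborel. \<bar>f x - U x\<bar>) \<le> renyi_csiszar_kullback_const p * sqrt (real_of_ereal (relative_renyi_entropy p f U))"
proof -
  define A where "A = (LINT x|lborel. f x powr p)"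
  define B where "B = (LINT x|lborel. U x powr p)"
  define S where "S = (LINT x|lborel. U x powr (2 - p))"
  define N where "N = (LINT x|lborel. \<bar>f x - U x\<bar>)"
  \<comment> \<open>A quadratic without linear term: its integral against a density depends only on
    mass and second moment, which \<open>f\<close> and \<open>U\<close> share.\<close>
  define h where "h x = a powr (p - 1) - a powr (p - 1) / r\<^sup>2 * x\<^sup>2" for x
  define K where "K = 16 / (p * (p - 1)) * (4 / 3) powr (1 / (p - 1))"
  have U0: "0 \<le> U x" for x
    using ar by (simp add: U_def barenblatt_shape_nonneg)
  have UB: "integrable lborel (\<lambda>x. U x powr (2 - p))" "integrable lborel (\<lambda>x. U x powr p)"
    "S * B \<le> 2 * (4 / 3) powr (1 / (p - 1))"
    unfolding S_def B_def
    using barenblatt_shape_powr_bounds[OF p ar U(1)[unfolded U_def]] by (simp_all add: U_def)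
  have pos: "0 < A" "0 < B" "0 < S"
    using f U U0 UB by (auto simp: A_def B_def S_def has_bochner_integral_iff intro!: integral_powr_pos)
  have hU: "U x powr (p - 1) = max 0 (h x)" for x
  proof -
    have "U x powr (p - 1) = a powr (p - 1) * max 0 (1 - (x / r)\<^sup>2)"
      using ar p by (simp add: U_def barenblatt_shape_def powr_mult powr_powr)
    also have "\<dots> = max 0 (a powr (p - 1) * (1 - (x / r)\<^sup>2))"
      using ar by (simp add: max_mult_distrib_left)
    also have "a powr (p - 1) * (1 - (x / r)\<^sup>2) = h x"
      by (simp add: h_def power_divide right_diff_distrib)
    finally show ?thesis .
  qed
  have h_int: "has_bochner_integral lborel (\<lambda>x. h x * g x) (a powr (p - 1) - a powr (p - 1) / r\<^sup>2 * \<Theta>)"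
    if "has_bochner_integral lborel g 1" "has_bochner_integral lborel (\<lambda>x. x\<^sup>2 * g x) \<Theta>" for g
  proof -
    have "has_bochner_integral lborel (\<lambda>x. a powr (p - 1) * g x - a powr (p - 1) / r\<^sup>2 * (x\<^sup>2 * g x))
        (a powr (p - 1) * 1 - a powr (p - 1) / r\<^sup>2 * \<Theta>)"
      using that by (intro has_bochner_integral_diff has_bochner_integral_mult_right) auto
    then show ?thesis by (simp add: h_def left_diff_distrib mult.assoc)
  qed
  have ck: "N\<^sup>2 \<le> 8 / (p * (p - 1)) * (S * (A - B))"
    unfolding N_def S_def A_def B_def
  proof (rule csiszar_kullback_powr[where h = h])
    show "(LINT x|lborel. h x * f x) = (LINT x|lborel. h x * U x)"
      using h_int[OF f(2,3)] h_int[OF U] by (simp add: has_bochner_integral_iff)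
  qed (use p f U U0 UB hU h_int[OF f(2,3)] h_int[OF U] in \<open>auto simp: has_bochner_integral_iff\<close>)
  \<comment> \<open>The left side of \<open>ck\<close> is a square, so \<open>B \<le> A\<close>;
    hence the relative entropy is non-negative.\<close>
  then have "0 \<le> 8 / (p * (p - 1)) * S * (A - B)"
    by (simp only: mult.assoc) (rule order_trans[rotated], assumption, simp)
  moreover have "0 < 8 / (p * (p - 1)) * S" using p pos by simp
  ultimately have AB: "B \<le> A"
    using zero_le_mult_iff[of "8 / (p * (p - 1)) * S" "A - B"] by linarith
  \<comment> \<open>Dividing by \<open>B\<close> brings out the scale-invariant product
    \<open>S * B\<close> and makes \<open>1 + y\<close> the argument of the logarithm.\<close>
  define y where "y = (A - B) / B"
  have y: "0 \<le> y" "1 + y = A / B" "A - B = B * y"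
    using AB pos by (auto simp: y_def field_simps)
  have "8 / (p * (p - 1)) * (S * (A - B)) = 8 / (p * (p - 1)) * y * (S * B)"
    unfolding y by simp
  also have "\<dots> \<le> 8 / (p * (p - 1)) * y * (2 * (4 / 3) powr (1 / (p - 1)))"
    using UB(3) y(1) p by (intro mult_left_mono) auto
  also have "\<dots> = K * y" by (simp add: K_def)
  finally have NK: "N\<^sup>2 \<le> K * y" using ck by simp
  \<comment> \<open>The bound that serves for large \<open>y\<close>.\<close>
  have "N \<le> (LINT x|lborel. f x + U x)"
    unfolding N_def using f U U0 by (intro integral_mono) (auto simp: has_bochner_integral_iff abs_le_iff)
  also have "\<dots> = 2" using f U by (simp add: has_bochner_integral_iff)
  finally have "N \<le> 2" .
  moreover have N0: "0 \<le> N" by (simp add: N_def)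
  ultimately have N4: "N\<^sup>2 \<le> 4" using power_mono[of N 2 2] by simp
  have "N\<^sup>2 \<le> (K + 4) * ln (1 + y)"
    using NK N4 y(1) p by (intro le_ln_one_plus) (auto simp: K_def)
  also have "ln (1 + y) = (p - 1) * real_of_ereal (relative_renyi_entropy p f U)"
    using p f UB pos unfolding y A_def B_def by (subst relative_renyi_entropy_eq_ln) auto
  finally have "N \<le> sqrt ((K + 4) * ((p - 1) * real_of_ereal (relative_renyi_entropy p f U)))"
    by (rule real_le_rsqrt)
  then show ?thesis
    by (simp add: N_def renyi_csiszar_kullback_const_def K_def real_sqrt_mult mult.assoc)
qed

section \<open>Integrability and positivity along the flow, and the estimate for solutions\<close>

lemma smooth_decaying_solution_powr_integrable:
  assumes p: "1 < p" and sol: "smooth_decaying_solution p u0 u" and t: "0 < t"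
  shows "integrable lborel (\<lambda>x. u t x powr p)"
proof -
  have cont: "continuous_on UNIV (u t)"
    using sol t unfolding smooth_decaying_solution_def by (intro continuous_on_slice[of "{0<..}"]) auto
  have u0: "0 \<le> u t x" for x
    using sol t unfolding smooth_decaying_solution_def by auto
  have "(u t \<longlongrightarrow> 0) at_infinity"
    using sol t unfolding smooth_decaying_solution_def by auto
  then have "\<forall>\<^sub>F x in at_infinity. dist (u t x) 0 < 1"
    by (rule tendstoD) simp
  then obtain R where R: "\<bar>u t x\<bar> < 1" if "R \<le> \<bar>x\<bar>" for x
    unfolding eventually_at_infinity by auto
  have "bounded (u t ` {-R..R})"
    by (intro compact_imp_bounded compact_continuous_image continuous_on_subset[OF cont]) auto
  then obtain B where "\<forall>x\<in>{-R..R}. \<bar>u t x\<bar> \<le> B"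
    unfolding bounded_iff by auto
  then have B: "\<bar>u t x\<bar> \<le> B" if "x \<in> {-R..R}" for x
    using that by blast
  \<comment> \<open>A global bound for \<open>u t\<close>: 1 from the decay at infinity,
    \<open>B\<close> from compactness.\<close>
  define M where "M = max 1 B"
  have M: "u t x \<le> M" for x
  proof (cases "R \<le> \<bar>x\<bar>")
    case True
    then show ?thesis using R[of x] by (auto simp: M_def)
  next
    case False
    then have "\<bar>u t x\<bar> \<le> B" by (intro B) auto
    then show ?thesis by (simp add: M_def)
  qed
  have le: "u t x powr p \<le> M powr (p - 1) * u t x" for x
  proof (cases "u t x = 0")
    case False
    then have "u t x powr p = u t x powr (p - 1) * u t x"
      using u0[of x] by (simp add: powr_diff)
    then show ?thesis using u0[of x] M[of x] p by (auto intro!: mult_right_mono powr_mono2)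
  qed simp
  have int: "integrable lborel (u t)" by (rule smooth_decaying_solution_integrable[OF sol t])
  then have [measurable]: "u t \<in> borel_measurable borel" by auto
  have "integrable lborel (\<lambda>x. M powr (p - 1) * u t x)" using int by simp
  then show ?thesis
    by (rule Bochner_Integration.integrable_bound) (use le u0 in auto)
qed

text \<open>A vanishing second moment would concentrate \<open>f\<close> on the null set consisting
  of 0. Positivity makes the profile's parameters admissible.\<close>

lemma second_moment_pos:
  fixes f :: "real \<Rightarrow> real"
  assumes "\<And>x. 0 \<le> f x" "integrable lborel (\<lambda>x. x\<^sup>2 * f x)" "0 < (LINT x|lborel. f x)"
  shows "0 < (LINT x|lborel. x\<^sup>2 * f x)"
proof (rule ccontr)
  assume "\<not> 0 < (LINT x|lborel. x\<^sup>2 * f x)"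
  moreover have "0 \<le> (LINT x|lborel. x\<^sup>2 * f x)" using assms(1) by simp
  ultimately have "(LINT x|lborel. x\<^sup>2 * f x) = 0" by linarith
  then have "AE x in lborel. x\<^sup>2 * f x = 0"
    using assms by (subst (asm) integral_nonneg_eq_0_iff_AE) auto
  moreover have "AE x in lborel. x \<noteq> (0::real)" by (rule AE_lborel_singleton)
  ultimately have "AE x in lborel. f x = 0" by eventually_elim simp
  then have "(LINT x|lborel. f x) = 0"
    using integral_eq_zero_AE by blast
  with assms(3) show False by simp
qed

theorem theorem3p1:
  fixes p :: real
  assumes "1 < p" and "p \<le> 3 / 2"
  shows "\<exists>C>0. \<forall>(u :: real \<Rightarrow> real \<Rightarrow> real) (u0 :: real \<Rightarrow> real) (\<Theta>0 :: real).
    smooth_decaying_solution p u0 u \<and>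
    (\<forall>x. 0 \<le> u0 x) \<and>
    has_bochner_integral lborel u0 1 \<and>
    has_bochner_integral lborel (\<lambda>x. x * u0 x) 0 \<and>
    has_bochner_integral lborel (\<lambda>x. x\<^sup>2 * u0 x) \<Theta>0 \<and>
    renyi_entropy p u0 < \<infinity> \<longrightarrow>
    (\<forall>t>0. let U = barenblatt_profile p \<Theta>0 (second_moment (u t)) in
       (\<integral>\<^sup>+x. ennreal \<bar>u t x - U x\<bar> \<partial>lborel)
         \<le> ennreal (C * sqrt (real_of_ereal (relative_renyi_entropy p (u t) U))))"
proof (intro exI[of _ "renyi_csiszar_kullback_const p"] conjI allI impI)
  have "0 \<le> 16 / (p * (p - 1)) * (4 / 3) powr (1 / (p - 1))" using assms by simp
  then show "0 < renyi_csiszar_kullback_const p"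
    using assms unfolding renyi_csiszar_kullback_const_def by (intro real_sqrt_gt_zero mult_pos_pos add_nonneg_pos) auto
next
  fix u :: "real \<Rightarrow> real \<Rightarrow> real" and u0 :: "real \<Rightarrow> real" and \<Theta>0 t :: real
  assume "smooth_decaying_solution p u0 u \<and>
    (\<forall>x. 0 \<le> u0 x) \<and>
    has_bochner_integral lborel u0 1 \<and>
    has_bochner_integral lborel (\<lambda>x. x * u0 x) 0 \<and>
    has_bochner_integral lborel (\<lambda>x. x\<^sup>2 * u0 x) \<Theta>0 \<and>
    renyi_entropy p u0 < \<infinity>" and t: "0 < t"
  then have sol: "smooth_decaying_solution p u0 u" and u0: "\<And>x. 0 \<le> u0 x"
    "has_bochner_integral lborel u0 1" "has_bochner_integral lborel (\<lambda>x. x\<^sup>2 * u0 x) \<Theta>0"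
    by auto
  define \<Theta>t where "\<Theta>t = second_moment (u t)"
  define U where "U = barenblatt_profile p \<Theta>0 \<Theta>t"
  have ut: "\<And>x. 0 \<le> u t x" and ut2: "has_bochner_integral lborel (\<lambda>x. x\<^sup>2 * u t x) \<Theta>t"
    using sol t unfolding smooth_decaying_solution_def
    by (auto simp: \<Theta>t_def second_moment_def has_bochner_integral_iff)
  have ut1: "has_bochner_integral lborel (u t) 1"
    using smooth_decaying_solution_integrable[OF sol t]
      smooth_decaying_solution_mass[OF assms(1) sol _ t] u0(2)
    by (auto simp: has_bochner_integral_iff)
  have \<Theta>: "0 < \<Theta>0" "0 < \<Theta>t"
    using second_moment_pos[of u0] second_moment_pos[of "u t"] u0 ut ut1 ut2
    by (auto simp: has_bochner_integral_iff)
  obtain a r where ar: "0 < a" "0 < r"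
    and U: "U = (\<lambda>x. a * barenblatt_shape (1 / (p - 1)) (x / r))"
      "has_bochner_integral lborel U 1" "has_bochner_integral lborel (\<lambda>x. x\<^sup>2 * U x) \<Theta>t"
    using barenblatt_profile_eq_shape[OF assms(1) \<Theta>] unfolding U_def by metis
  have "(LINT x|lborel. \<bar>u t x - U x\<bar>)
      \<le> renyi_csiszar_kullback_const p * sqrt (real_of_ereal (relative_renyi_entropy p (u t) U))"
    using l1_dist_barenblatt_le_relative_renyi_entropy[OF assms(1) _ ar ut ut1 ut2
        smooth_decaying_solution_powr_integrable[OF assms(1) sol t]] U assms by simp
  moreover have "(\<integral>\<^sup>+x. ennreal \<bar>u t x - U x\<bar> \<partial>lborel) = ennreal (LINT x|lborel. \<bar>u t x - U x\<bar>)"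
    using ut1 U(2) by (intro nn_integral_eq_integral) (auto simp: has_bochner_integral_iff)
  ultimately show "let U = barenblatt_profile p \<Theta>0 (second_moment (u t)) in
       (\<integral>\<^sup>+x. ennreal \<bar>u t x - U x\<bar> \<partial>lborel)
         \<le> ennreal (renyi_csiszar_kullback_const p * sqrt (real_of_ereal (relative_renyi_entropy p (u t) U)))"
    by (simp add: U_def \<Theta>t_def Let_def ennreal_leI)
qed

end
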